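(* Let $\mathbf{A}$ be a distributive nearlattice. Then the following are equivalent: (1) $\mathbf{A}$ is normal and quasicomplemented; (2) $\mathrm{R}(A)=\{a^{\top}\colon a\in A\}$ is a Boolean algebra, in the sense that every element of $\mathrm{R}(A)$ has a complement in $\mathrm{R}(A)$ with respect to the operations of $\mathrm{Fi}(A)$: for each $a\in A$ there exists $b\in A$ with $a^{\top}\cap b^{\top}=\{1\}$ and $a^{\top}\veebar b^{\top}=A$.
   Context: A distributive nearlattice is a join-semilattice $\langle A,\vee,1\rangle$ with greatest element $1$ in which every principal filter $[a)=\{x\in A\colon a\le x\}$ is a bounded distributive lattice. A filter of $A$ is a subset containing $1$, upward closed, and closed under those binary meets that exist; $\mathrm{Fi}(A)$ is the lattice of filters with meet $\cap$, join $F\veebar G$ the smallest filter containing $F\cup G$, bottom $\{1\}$, top $A$. For $a\in A$, $a^{\top}=\{x\in A\colon x\vee a=1\}$ and $a^{\top\top}=\{y\in A\colon y\vee x=1\text{ for all }x\in a^{\top}\}$. An ideal is a downward closed, $\vee$-closed subset; a prime ideal is a non-empty proper ideal $P$ with $a\wedge b\in P\Rightarrow a\in P$ or $b\in P$ whenever $a\wedge b$ exists; a maximal ideal is a non-empty proper ideal not properly contained in any proper ideal. $\mathbf{A}$ is normal if each prime ideal is contained in a unique maximal ideal; $\mathbf{A}$ is quasicomplemented if for each $a\in A$ there exists $b\in A$ with $a^{\top\top}=b^{\top}$. *)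

theory Defs
  imports Main "HOL.Hull"
begin

context order
begin

definition is_meet_on :: "'a set \<Rightarrow> 'a \<Rightarrow> 'a \<Rightarrow> 'a \<Rightarrow> bool" where
  "is_meet_on S x y m \<longleftrightarrow>
     m \<in> S \<and> m \<le> x \<and> m \<le> y \<and> (\<forall>z\<in>S. z \<le> x \<and> z \<le> y \<longrightarrow> z \<le> m)"

definition is_join_on :: "'a set \<Rightarrow> 'a \<Rightarrow> 'a \<Rightarrow> 'a \<Rightarrow> bool" where
  "is_join_on S x y j \<longleftrightarrow>
     j \<in> S \<and> x \<le> j \<and> y \<le> j \<and> (\<forall>z\<in>S. x \<le> z \<and> y \<le> z \<longrightarrow> j \<le> z)"

text \<open>The operators below are meaningful only when the meet (join) relative to \<open>S\<close> exists.\<close>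

definition meet_on :: "'a set \<Rightarrow> 'a \<Rightarrow> 'a \<Rightarrow> 'a" where
  "meet_on S x y = (THE m. is_meet_on S x y m)"

definition join_on :: "'a set \<Rightarrow> 'a \<Rightarrow> 'a \<Rightarrow> 'a" where
  "join_on S x y = (THE j. is_join_on S x y j)"

definition bounded_distrib_lattice_on :: "'a set \<Rightarrow> bool" where
  "bounded_distrib_lattice_on S \<longleftrightarrow>
     (\<exists>b\<in>S. \<forall>x\<in>S. b \<le> x) \<and>
     (\<exists>t\<in>S. \<forall>x\<in>S. x \<le> t) \<and>
     (\<forall>x\<in>S. \<forall>y\<in>S. (\<exists>m. is_meet_on S x y m) \<and> (\<exists>j. is_join_on S x y j)) \<and>
     (\<forall>x\<in>S. \<forall>y\<in>S. \<forall>z\<in>S.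
        meet_on S x (join_on S y z) = join_on S (meet_on S x y) (meet_on S x z))"

end

text \<open>The carrier of the nearlattice is the whole type; its join is \<open>sup\<close> and its greatest
  element is \<open>top\<close>. The principal filter of \<open>a\<close> is \<open>{a..}\<close>.\<close>

class distributive_nearlattice = semilattice_sup + order_top +
  assumes principal_filter_bounded_distrib_lattice: "bounded_distrib_lattice_on {a..}"

definition nl_filter :: "'a::distributive_nearlattice set \<Rightarrow> bool" where
  "nl_filter F \<longleftrightarrow>
     top \<in> F \<and>
     (\<forall>x\<in>F. \<forall>y. x \<le> y \<longrightarrow> y \<in> F) \<and>
     (\<forall>x\<in>F. \<forall>y\<in>F. \<forall>m. is_meet_on UNIV x y m \<longrightarrow> m \<in> F)"

definition filter_join ::
    "'a::distributive_nearlattice set \<Rightarrow> 'a set \<Rightarrow> 'a set" (infixl "\<veebar>" 65) where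
  "F \<veebar> G = nl_filter hull (F \<union> G)"

definition annihilator :: "'a::distributive_nearlattice \<Rightarrow> 'a set" ("(_\<^sup>\<top>)" [1000] 999) where
  "a\<^sup>\<top> = {x. sup x a = top}"

definition double_annihilator ::
    "'a::distributive_nearlattice \<Rightarrow> 'a set" ("(_\<^sup>\<top>\<^sup>\<top>)" [1000] 999) where
  "a\<^sup>\<top>\<^sup>\<top> = {y. \<forall>x\<in>a\<^sup>\<top>. sup y x = top}"

definition nl_ideal :: "'a::distributive_nearlattice set \<Rightarrow> bool" where
  "nl_ideal I \<longleftrightarrow>
     (\<forall>x\<in>I. \<forall>y. y \<le> x \<longrightarrow> y \<in> I) \<and> (\<forall>x\<in>I. \<forall>y\<in>I. sup x y \<in> I)"

definition prime_ideal :: "'a::distributive_nearlattice set \<Rightarrow> bool" where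
  "prime_ideal P \<longleftrightarrow>
     nl_ideal P \<and> P \<noteq> {} \<and> P \<noteq> UNIV \<and>
     (\<forall>a b m. is_meet_on UNIV a b m \<and> m \<in> P \<longrightarrow> a \<in> P \<or> b \<in> P)"

definition maximal_ideal :: "'a::distributive_nearlattice set \<Rightarrow> bool" where
  "maximal_ideal M \<longleftrightarrow>
     nl_ideal M \<and> M \<noteq> {} \<and> M \<noteq> UNIV \<and>
     \<not> (\<exists>J. nl_ideal J \<and> J \<noteq> UNIV \<and> M \<subset> J)"

definition normal_nearlattice :: "'a::distributive_nearlattice itself \<Rightarrow> bool" where
  "normal_nearlattice _ \<longleftrightarrow>
     (\<forall>P :: 'a set. prime_ideal P \<longrightarrow> (\<exists>!M. maximal_ideal M \<and> P \<subseteq> M))"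

definition quasicomplemented :: "'a::distributive_nearlattice itself \<Rightarrow> bool" where
  "quasicomplemented _ \<longleftrightarrow> (\<forall>a::'a. \<exists>b. a\<^sup>\<top>\<^sup>\<top> = b\<^sup>\<top>)"

definition annihilator_set :: "'a::distributive_nearlattice set set" where
  "annihilator_set = {a\<^sup>\<top> | a. True}"

end

theory Submission
  imports Defs
begin

text \<open>Annihilators are filters, and maximal ideals disjoint from a filter are prime. If \<open>A\<close> is
  normal and \<open>a\<^sup>\<top>\<^sup>\<top> = b\<^sup>\<top>\<close>, but \<open>a\<^sup>\<top> \<veebar> b\<^sup>\<top>\<close> is proper, separate it from a point by a prime
  ideal \<open>P\<close>. Both \<open>P \<union> {a}\<close> and \<open>P \<union> {b}\<close> then extend to maximal ideals, which agree by
  normality, although \<open>sup a b = top\<close>. Conversely, let \<open>b\<^sup>\<top>\<close> be a complement of \<open>a\<^sup>\<top>\<close>. The filter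
  \<open>(sup y b)\<^sup>\<top>\<close> contains both for each \<open>y \<in> a\<^sup>\<top>\<^sup>\<top>\<close>, so \<open>sup y b = top\<close>. A prime ideal \<open>P\<close> meets
  one of \<open>a\<^sup>\<top>\<close>, \<open>a\<^sup>\<top>\<^sup>\<top>\<close>, which is impossible if \<open>P\<close> lies in maximal ideals \<open>M \<noteq> N\<close> with
  \<open>a \<in> M\<close>, \<open>y \<in> N\<close> and \<open>sup a y = top\<close>.\<close>

section \<open>Meets and joins in principal filters, and distributivity\<close>

lemma is_meet_on_unique:
  "is_meet_on S x y m \<Longrightarrow> is_meet_on S x y m' \<Longrightarrow> m = m'"
  unfolding is_meet_on_def by (meson order_antisym)

lemma meet_on_eqI: "is_meet_on S x y m \<Longrightarrow> meet_on S x y = m"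
  unfolding meet_on_def using is_meet_on_unique by blast

text \<open>Principal filters are upward closed, so \<open>sup x y\<close> stays inside and the
  relative join is the global one.\<close>

lemma join_on_atLeast:
  fixes m :: "'a::semilattice_sup"
  assumes "m \<le> x" "m \<le> y"
  shows "join_on {m..} x y = sup x y"
  unfolding join_on_def
proof (rule the_equality)
  show join: "is_join_on {m..} x y (sup x y)"
    using assms unfolding is_join_on_def by (auto intro: le_supI1)
  show "j = sup x y" if "is_join_on {m..} x y j" for j
    using that join unfolding is_join_on_def by (meson order_antisym)
qed

text \<open>Distributivity in \<open>{m..}\<close>: \<open>z\<close> is its own meet with
  \<open>sup x y\<close>, hence the join of its meets with \<open>x\<close> and \<open>y\<close>.
  These exist because \<open>m\<close> is a common lower bound.\<close>

lemma le_sup_decompose: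
  fixes m :: "'a::distributive_nearlattice"
  assumes m: "m \<le> x" "m \<le> y" "m \<le> z" and z: "z \<le> sup x y"
  obtains u v where "m \<le> u" "m \<le> v" "u \<le> x" "v \<le> y" "z = sup u v"
proof -
  have lat: "bounded_distrib_lattice_on {m..}"
    by (rule principal_filter_bounded_distrib_lattice)
  have "\<exists>u. is_meet_on {m..} z x u" "\<exists>v. is_meet_on {m..} z y v"
    using lat m unfolding bounded_distrib_lattice_on_def by auto
  then obtain u v where u: "is_meet_on {m..} z x u" and v: "is_meet_on {m..} z y v"
    by blast
  have uv: "m \<le> u" "m \<le> v" "u \<le> x" "v \<le> y"
    using u v unfolding is_meet_on_def by auto
  have "is_meet_on {m..} z (sup x y) z"
    using m z unfolding is_meet_on_def by auto
  then have "z = meet_on {m..} z (join_on {m..} x y)"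
    using meet_on_eqI m by (metis join_on_atLeast)
  also have "\<dots> = join_on {m..} (meet_on {m..} z x) (meet_on {m..} z y)"
    using lat m unfolding bounded_distrib_lattice_on_def by auto
  also have "\<dots> = sup u v"
    using u v uv by (simp add: meet_on_eqI join_on_atLeast)
  finally show thesis using that uv by blast
qed

text \<open>Decomposing a lower bound along \<open>a\<close> and then along \<open>b\<close> leaves
  a piece below both, hence below \<open>m\<close>. This is the form of distributivity that needs no
  common lower bound of \<open>k\<close> with \<open>a\<close> or \<open>b\<close>.\<close>

lemma sup_is_meet:
  fixes k :: "'a::distributive_nearlattice"
  assumes "is_meet_on UNIV a b m"
  shows "is_meet_on UNIV (sup k a) (sup k b) (sup k m)"
proof -
  have m: "m \<le> a" "m \<le> b" and glb: "\<And>w. w \<le> a \<Longrightarrow> w \<le> b \<Longrightarrow> w \<le> m"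
    using assms unfolding is_meet_on_def by auto
  have "z \<le> sup k m" if za: "z \<le> sup k a" and zb: "z \<le> sup k b" for z
  proof -
    let ?K = "sup k m"
    have Ka: "sup ?K a = sup k a" and Kb: "sup ?K b = sup k b"
      using m by (simp_all add: sup.assoc sup.absorb2)
    \<comment> \<open>\<open>z\<close> need not lie above \<open>m\<close>, whereas
      \<open>sup z m\<close> lies in \<open>{m..}\<close>, where decomposition is possible.\<close>
    have "sup z m \<le> sup ?K a"
      unfolding Ka using za m(1) by (simp add: le_supI2)
    then obtain u v where uv: "m \<le> v" "u \<le> ?K" "v \<le> a" "sup z m = sup u v"
      using le_sup_decompose[of m ?K a "sup z m"] m(1) by (metis sup_ge2)
    have "v \<le> sup z m" using uv by simp
    also have "\<dots> \<le> sup ?K b"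
      unfolding Kb using zb m(2) by (simp add: le_supI2)
    finally obtain s t where st: "s \<le> ?K" "t \<le> b" "v = sup s t"
      using le_sup_decompose[of m ?K b v] m(2) uv(1) by (metis sup_ge2)
    \<comment> \<open>Here \<open>t \<le> v \<le> a\<close> as well as
      \<open>t \<le> b\<close>.\<close>
    have "t \<le> m" using glb[of t] st uv by simp
    then have "v \<le> ?K" using st by (simp add: le_supI2)
    then have "sup z m \<le> ?K" using uv by simp
    then show ?thesis by simp
  qed
  then show ?thesis
    using m unfolding is_meet_on_def by (auto intro: le_supI2)
qed

section \<open>Annihilators and joins of filters\<close>

lemma mem_annihilator: "x \<in> a\<^sup>\<top> \<longleftrightarrow> sup x a = top"
  by (simp add: annihilator_def)

lemma mem_double_annihilator: "y \<in> a\<^sup>\<top>\<^sup>\<top> \<longleftrightarrow> (\<forall>x. sup x a = top \<longrightarrow> sup y x = top)"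
  by (simp add: double_annihilator_def annihilator_def)

lemma nl_filter_annihilator: "nl_filter (a\<^sup>\<top>)"
  unfolding nl_filter_def
proof (intro conjI ballI allI impI)
  show "top \<in> a\<^sup>\<top>" by (simp add: mem_annihilator sup.absorb1)
next
  fix x y assume "x \<in> a\<^sup>\<top>" "x \<le> y"
  then show "y \<in> a\<^sup>\<top>"
    by (metis mem_annihilator sup.mono order_refl top_unique)
next
  fix x y m assume xy: "x \<in> a\<^sup>\<top>" "y \<in> a\<^sup>\<top>" and "is_meet_on UNIV x y m"
  \<comment> \<open>Both \<open>sup a x\<close> and \<open>sup a y\<close> equal
    \<open>top\<close>.\<close>
  then have "is_meet_on UNIV top top (sup a m)"
    using sup_is_meet[of x y m a] by (simp add: mem_annihilator sup.commute)
  then have "top \<le> sup a m"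
    unfolding is_meet_on_def by blast
  then show "m \<in> a\<^sup>\<top>"
    by (simp add: mem_annihilator sup.commute top_unique)
qed

text \<open>Ensures that the hull defining \<open>\<veebar>\<close> is itself a filter.\<close>

lemma nl_filter_Inter:
  assumes "\<forall>F\<in>\<F>. nl_filter F"
  shows "nl_filter (\<Inter>\<F>)"
  unfolding nl_filter_def
proof (intro conjI ballI allI impI InterI)
  fix F assume F: "F \<in> \<F>"
  then have filter: "nl_filter F" using assms by blast
  then show "top \<in> F" unfolding nl_filter_def by blast
  show "y \<in> F" if "x \<in> \<Inter>\<F>" "x \<le> y" for x y
    using that F filter unfolding nl_filter_def by blast
  show "m \<in> F" if "x \<in> \<Inter>\<F>" "y \<in> \<Inter>\<F>" "is_meet_on UNIV x y m" for x y m
    using that F filter unfolding nl_filter_def by blast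
qed

lemma nl_filter_filter_join: "nl_filter (F \<veebar> G)"
  unfolding filter_join_def by (rule hull_in[where S = nl_filter]) (rule nl_filter_Inter)

lemma filter_join_upper: "F \<subseteq> F \<veebar> G" "G \<subseteq> F \<veebar> G"
  unfolding filter_join_def using hull_subset[of "F \<union> G"] by auto

lemma filter_join_least: "nl_filter H \<Longrightarrow> F \<subseteq> H \<Longrightarrow> G \<subseteq> H \<Longrightarrow> F \<veebar> G \<subseteq> H"
  unfolding filter_join_def by (rule hull_minimal) auto

section \<open>Maximal and prime ideals\<close>

lemma nl_ideal_proper_iff: "nl_ideal I \<Longrightarrow> I \<noteq> UNIV \<longleftrightarrow> top \<notin> I"
  unfolding nl_ideal_def by (metis UNIV_I UNIV_eq_I top_greatest)

lemma nl_filter_Compl_prime_ideal: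
  assumes "prime_ideal P"
  shows "nl_filter (- P)"
proof -
  have "top \<notin> P"
    using assms nl_ideal_proper_iff unfolding prime_ideal_def by blast
  then show ?thesis
    unfolding nl_filter_def
  proof (intro conjI ballI allI impI)
    show "y \<in> - P" if "x \<in> - P" "x \<le> y" for x y
      using assms that unfolding prime_ideal_def nl_ideal_def by blast
    show "m \<in> - P" if "x \<in> - P" "y \<in> - P" "is_meet_on UNIV x y m" for x y m
      using assms that unfolding prime_ideal_def by blast
  qed simp
qed

text \<open>For nonempty \<open>I\<close> this set is the ideal generated by \<open>I\<close> and
  \<open>a\<close>.\<close>

lemma nl_ideal_extend:
  "nl_ideal I \<Longrightarrow> nl_ideal {x. \<exists>i\<in>I. x \<le> sup i a}"
  unfolding nl_ideal_def
proof (intro conjI ballI allI impI; clarsimp)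
  fix x y i
  assume "i \<in> I" "x \<le> sup i a" "y \<le> x"
  then show "\<exists>i\<in>I. y \<le> sup i a" using order_trans by blast
next
  fix x y i j
  assume "\<forall>x\<in>I. \<forall>y\<in>I. sup x y \<in> I" "i \<in> I" "j \<in> I" and x: "x \<le> sup i a" and y: "y \<le> sup j a"
  moreover have "x \<le> sup (sup i j) a" "y \<le> sup (sup i j) a"
    by (rule order_trans[OF x] order_trans[OF y], simp add: le_supI1)+
  ultimately show "\<exists>k\<in>I. x \<le> sup k a \<and> y \<le> sup k a" by blast
qed

lemma subset_ideal_extend: "I \<subseteq> {x. \<exists>i\<in>I. x \<le> sup i (a::'a::distributive_nearlattice)}"
  using sup_ge1 by blast

text \<open>Zorn's lemma. The choice \<open>F = {top}\<close> produces maximal ideals, and a filter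
  \<open>F\<close> produces prime ones.\<close>

lemma exists_ideal_maximal_disjoint:
  fixes I F :: "'a::distributive_nearlattice set"
  assumes "nl_ideal I" "I \<inter> F = {}"
  obtains M where "nl_ideal M" "I \<subseteq> M" "M \<inter> F = {}"
    "\<And>J. nl_ideal J \<Longrightarrow> M \<subseteq> J \<Longrightarrow> J \<inter> F = {} \<Longrightarrow> J = M"
proof -
  let ?A = "{J. nl_ideal J \<and> I \<subseteq> J \<and> J \<inter> F = {}}"
  have "\<exists>M\<in>?A. \<forall>J\<in>?A. M \<subseteq> J \<longrightarrow> J = M"
  proof (rule subset_Zorn_nonempty)
    show "?A \<noteq> {}" using assms by blast
  next
    fix C assume "C \<noteq> {}" and C: "subset.chain ?A C"
    have sub: "C \<subseteq> ?A" and tot: "\<And>X Y. X \<in> C \<Longrightarrow> Y \<in> C \<Longrightarrow> X \<subseteq> Y \<or> Y \<subseteq> X"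
      using C unfolding subset_chain_def by blast+
    have "nl_ideal (\<Union>C)"
      unfolding nl_ideal_def
    proof (intro conjI ballI allI impI)
      fix x y assume "x \<in> \<Union>C" "y \<le> x"
      then show "y \<in> \<Union>C" using sub unfolding nl_ideal_def by blast
    next
      fix x y assume "x \<in> \<Union>C" "y \<in> \<Union>C"
      then obtain X where "X \<in> C" "x \<in> X" "y \<in> X" using tot by blast
      then show "sup x y \<in> \<Union>C" using sub unfolding nl_ideal_def by blast
    qed
    then show "\<Union>C \<in> ?A" using sub \<open>C \<noteq> {}\<close> by blast
  qed
  then show thesis using that by (smt (verit) mem_Collect_eq order_trans)
qed

lemma exists_maximal_ideal:
  assumes "nl_ideal I" "I \<noteq> {}" "top \<notin> I"
  obtains M where "maximal_ideal M" "I \<subseteq> M"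
proof -
  obtain M where M: "nl_ideal M" "I \<subseteq> M" "M \<inter> {top} = {}"
    "\<And>J. nl_ideal J \<Longrightarrow> M \<subseteq> J \<Longrightarrow> J \<inter> {top} = {} \<Longrightarrow> J = M"
    using exists_ideal_maximal_disjoint[of I "{top}"] assms by blast
  have "\<not> M \<subset> J" if "nl_ideal J" "J \<noteq> UNIV" for J
    using M(4)[of J] that nl_ideal_proper_iff by blast
  then have "maximal_ideal M"
    using M assms(2) nl_ideal_proper_iff unfolding maximal_ideal_def by blast
  then show thesis using that M by blast
qed

text \<open>Disjointness from \<open>a\<^sup>\<top>\<close> says exactly that the ideal generated by
  \<open>I\<close> and \<open>a\<close> omits \<open>top\<close>.\<close>

lemma exists_maximal_ideal_insert:
  assumes I: "nl_ideal I" "I \<noteq> {}" and disj: "I \<inter> a\<^sup>\<top> = {}"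
  obtains M where "maximal_ideal M" "I \<subseteq> M" "a \<in> M"
proof -
  let ?J = "{x. \<exists>i\<in>I. x \<le> sup i a}"
  have "a \<in> ?J" using I by auto
  moreover have "top \<notin> ?J" using disj by (auto simp: mem_annihilator top_unique)
  ultimately obtain M where "maximal_ideal M" "?J \<subseteq> M"
    using exists_maximal_ideal[of ?J] nl_ideal_extend[OF I(1), of a] by blast
  then show thesis using that[of M] \<open>a \<in> ?J\<close> subset_ideal_extend[of I a] by blast
qed

text \<open>By maximality the ideal generated by \<open>M\<close> and \<open>x\<close> must contain
  \<open>top\<close>.\<close>

lemma maximal_ideal_sup_eq_top:
  assumes M: "maximal_ideal M" and x: "x \<notin> M"
  obtains y where "y \<in> M" "sup x y = top"
proof -
  let ?J = "{z. \<exists>i\<in>M. z \<le> sup i x}"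
  have "nl_ideal M" "M \<noteq> {}" using M unfolding maximal_ideal_def by auto
  moreover from \<open>M \<noteq> {}\<close> have "x \<in> ?J" by auto
  ultimately have "nl_ideal ?J" "M \<subset> ?J"
    using x nl_ideal_extend subset_ideal_extend[of M x] by blast+
  then have "top \<in> ?J" using M nl_ideal_proper_iff unfolding maximal_ideal_def by blast
  then show thesis using that by (auto simp: top_unique sup.commute)
qed

text \<open>The prime ideal separation theorem: an ideal above \<open>{..c}\<close> that is maximal
  among those avoiding \<open>F\<close> is prime, by distributivity.\<close>

lemma exists_prime_ideal:
  assumes F: "nl_filter F" and c: "c \<notin> F"
  obtains P where "prime_ideal P" "c \<in> P" "P \<inter> F = {}"
proof -
  have up: "\<And>x y. x \<in> F \<Longrightarrow> x \<le> y \<Longrightarrow> y \<in> F"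
    using F unfolding nl_filter_def by blast
  have "nl_ideal {..c}" unfolding nl_ideal_def by auto
  moreover have "{..c} \<inter> F = {}" using up c by auto
  ultimately obtain P where P: "nl_ideal P" "{..c} \<subseteq> P" "P \<inter> F = {}"
    and max: "\<And>J. nl_ideal J \<Longrightarrow> P \<subseteq> J \<Longrightarrow> J \<inter> F = {} \<Longrightarrow> J = P"
    using exists_ideal_maximal_disjoint by blast
  have c_in: "c \<in> P" using P by auto
  have sup_in: "\<exists>i\<in>P. sup i a \<in> F" if "a \<notin> P" for a
  proof -
    let ?J = "{x. \<exists>i\<in>P. x \<le> sup i a}"
    have "a \<in> ?J" using c_in by auto
    then have "?J \<inter> F \<noteq> {}"
      using max[of ?J] nl_ideal_extend[OF P(1)] subset_ideal_extend[of P a] that by blast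
    then show ?thesis using up by blast
  qed
  have "a \<in> P \<or> b \<in> P" if m: "is_meet_on UNIV a b m" "m \<in> P" for a b m
  proof (rule ccontr)
    assume "\<not> (a \<in> P \<or> b \<in> P)"
    then obtain i j where ij: "i \<in> P" "j \<in> P" "sup i a \<in> F" "sup j b \<in> F"
      using sup_in by blast
    \<comment> \<open>One element of \<open>P\<close> serving both \<open>a\<close> and
      \<open>b\<close>, so that \<open>sup ?k m\<close> is the meet of two members of
      \<open>F\<close>.\<close>
    let ?k = "sup i j"
    have "sup ?k a \<in> F" "sup ?k b \<in> F"
      using ij up by (meson order_refl sup.mono sup_ge1 sup_ge2)+
    then have "sup ?k m \<in> F"
      using F sup_is_meet[OF m(1)] unfolding nl_filter_def by blast
    moreover have "sup ?k m \<in> P" using P(1) ij m(2) unfolding nl_ideal_def by blast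
    ultimately show False using P by blast
  qed
  moreover have "top \<in> F" using F unfolding nl_filter_def by blast
  ultimately have "prime_ideal P" using P c_in unfolding prime_ideal_def by blast
  then show thesis using that c_in P by blast
qed

section \<open>The two directions of the equivalence\<close>

lemma double_annihilator_eq_complement:
  assumes disj: "a\<^sup>\<top> \<inter> b\<^sup>\<top> = {top}" and join: "a\<^sup>\<top> \<veebar> b\<^sup>\<top> = UNIV"
  shows "a\<^sup>\<top>\<^sup>\<top> = b\<^sup>\<top>"
proof (intro equalityI subsetI)
  fix y assume y: "y \<in> b\<^sup>\<top>"
  have "sup y x = top" if "sup x a = top" for x
  proof -
    have "sup y x \<in> b\<^sup>\<top>"
      using y nl_filter_annihilator[of b] unfolding nl_filter_def by (meson sup_ge1)
    moreover have "sup y x \<in> a\<^sup>\<top>"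
      using that nl_filter_annihilator[of a] unfolding nl_filter_def
      by (meson sup_ge2 mem_annihilator)
    ultimately show ?thesis using disj by blast
  qed
  then show "y \<in> a\<^sup>\<top>\<^sup>\<top>" by (simp add: mem_double_annihilator)
next
  fix y assume y: "y \<in> a\<^sup>\<top>\<^sup>\<top>"
  have "a\<^sup>\<top> \<subseteq> (sup y b)\<^sup>\<top>"
  proof
    fix x assume "x \<in> a\<^sup>\<top>"
    then have "sup y x = top" using y by (simp add: mem_double_annihilator mem_annihilator)
    then have "sup (sup y x) b = top" by (simp add: sup.absorb1)
    then show "x \<in> (sup y b)\<^sup>\<top>" by (simp add: mem_annihilator sup.left_commute sup.assoc)
  qed
  moreover have "b\<^sup>\<top> \<subseteq> (sup y b)\<^sup>\<top>"
    by (auto simp: mem_annihilator sup.left_commute[of _ y] sup.absorb2)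
  ultimately have "UNIV \<subseteq> (sup y b)\<^sup>\<top>"
    using filter_join_least[OF nl_filter_annihilator] join by metis
  \<comment> \<open>An element that lies in its own annihilator is \<open>top\<close>, since
    \<open>sup\<close> is idempotent.\<close>
  then have "sup y b \<in> (sup y b)\<^sup>\<top>" by blast
  then show "y \<in> b\<^sup>\<top>" by (simp add: mem_annihilator)
qed

lemma normal_imp_filter_join_UNIV:
  fixes a b :: "'a::distributive_nearlattice"
  assumes normal: "normal_nearlattice TYPE('a)" and ab: "sup a b = top"
  shows "a\<^sup>\<top> \<veebar> b\<^sup>\<top> = UNIV"
proof (rule ccontr)
  assume "a\<^sup>\<top> \<veebar> b\<^sup>\<top> \<noteq> UNIV"
  then obtain P where P: "prime_ideal P" "P \<inter> (a\<^sup>\<top> \<veebar> b\<^sup>\<top>) = {}"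
    using exists_prime_ideal[OF nl_filter_filter_join] by blast
  then have "nl_ideal P" "P \<noteq> {}" "P \<inter> a\<^sup>\<top> = {}" "P \<inter> b\<^sup>\<top> = {}"
    using filter_join_upper[where F = "a\<^sup>\<top>" and G = "b\<^sup>\<top>"] unfolding prime_ideal_def by blast+
  then obtain M N where M: "maximal_ideal M" "P \<subseteq> M" "a \<in> M"
    and N: "maximal_ideal N" "P \<subseteq> N" "b \<in> N"
    using exists_maximal_ideal_insert by metis
  \<comment> \<open>Both maximal ideals contain the prime ideal \<open>P\<close>.\<close>
  have "M = N" using normal P(1) M N unfolding normal_nearlattice_def by blast
  then have "top \<in> M" using M N ab unfolding maximal_ideal_def nl_ideal_def by metis
  then show False using M(1) nl_ideal_proper_iff unfolding maximal_ideal_def by blast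
qed

lemma normal_nearlatticeI:
  assumes compl: "\<And>a::'a::distributive_nearlattice. a\<^sup>\<top> \<veebar> a\<^sup>\<top>\<^sup>\<top> = UNIV"
  shows "normal_nearlattice TYPE('a)"
  unfolding normal_nearlattice_def
proof (intro allI impI ex_ex1I)
  fix P :: "'a set" assume P: "prime_ideal P"
  then show "\<exists>M. maximal_ideal M \<and> P \<subseteq> M"
    using exists_maximal_ideal[of P] nl_ideal_proper_iff unfolding prime_ideal_def by metis
next
  fix P M N :: "'a set"
  assume P: "prime_ideal P" and M: "maximal_ideal M \<and> P \<subseteq> M" and N: "maximal_ideal N \<and> P \<subseteq> N"
  show "M = N"
  proof (rule ccontr)
    assume "M \<noteq> N"
    \<comment> \<open>Distinct maximal ideals are incomparable.\<close>
    then obtain x where x: "x \<in> M" "x \<notin> N"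
      using M N unfolding maximal_ideal_def by blast
    then obtain y where y: "y \<in> N" "sup x y = top"
      using maximal_ideal_sup_eq_top N by blast
    have sup_ne: "sup u v \<noteq> top" if "u \<in> K" "v \<in> K" "maximal_ideal K" for u v and K :: "'a set"
      using that nl_ideal_proper_iff unfolding maximal_ideal_def nl_ideal_def by metis
    \<comment> \<open>An element of \<open>P\<close> in \<open>x\<^sup>\<top>\<close> would,
      together with \<open>x\<close>, put \<open>top\<close> into \<open>M\<close>.\<close>
    have "x\<^sup>\<top> \<subseteq> - P" using sup_ne[of _ M x] M x by (auto simp: mem_annihilator)
    \<comment> \<open>Since \<open>y \<in> x\<^sup>\<top>\<close>, an element of \<open>P\<close> in
      \<open>x\<^sup>\<top>\<^sup>\<top>\<close> would, together with \<open>y\<close>, put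
      \<open>top\<close> into \<open>N\<close>.\<close>
    moreover have "x\<^sup>\<top>\<^sup>\<top> \<subseteq> - P"
      using sup_ne[of _ N y] N y
      by (metis ComplI mem_double_annihilator subset_eq sup.commute)
    \<comment> \<open>Primality makes \<open>- P\<close> a filter, so it contains the join of the
      two annihilators.\<close>
    ultimately have "UNIV \<subseteq> - P"
      using filter_join_least[OF nl_filter_Compl_prime_ideal[OF P]] compl by metis
    then show False using P unfolding prime_ideal_def by blast
  qed
qed

theorem theorem4p9:
  shows "normal_nearlattice TYPE('a::distributive_nearlattice) \<and> quasicomplemented TYPE('a) \<longleftrightarrow>
    (\<forall>F \<in> (annihilator_set :: 'a set set). \<exists>G \<in> annihilator_set.
       F \<inter> G = {top} \<and> F \<veebar> G = UNIV)"
proof -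
  have range: "(annihilator_set :: 'a set set) = range annihilator"
    unfolding annihilator_set_def by blast
  have "(\<forall>F \<in> (annihilator_set :: 'a set set). \<exists>G \<in> annihilator_set. F \<inter> G = {top} \<and> F \<veebar> G = UNIV)
    \<longleftrightarrow> (\<forall>a::'a. \<exists>b. a\<^sup>\<top> \<inter> b\<^sup>\<top> = {top} \<and> a\<^sup>\<top> \<veebar> b\<^sup>\<top> = UNIV)" (is "_ \<longleftrightarrow> ?boolean")
    unfolding range by simp
  moreover have ?boolean
    if normal: "normal_nearlattice TYPE('a)" and quasi: "quasicomplemented TYPE('a)"
  proof
    fix a :: 'a
    obtain b where b: "a\<^sup>\<top>\<^sup>\<top> = b\<^sup>\<top>" using quasi unfolding quasicomplemented_def by blast
    have "a \<in> b\<^sup>\<top>"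
      unfolding b[symmetric] by (simp add: mem_double_annihilator sup.commute)
    then have "a\<^sup>\<top> \<veebar> b\<^sup>\<top> = UNIV"
      using normal_imp_filter_join_UNIV[OF normal] by (simp add: mem_annihilator)
    \<comment> \<open>A common element \<open>x\<close> of \<open>a\<^sup>\<top>\<close> and
      \<open>a\<^sup>\<top>\<^sup>\<top>\<close> satisfies \<open>sup x x = top\<close>.\<close>
    moreover have "a\<^sup>\<top> \<inter> b\<^sup>\<top> = {top}"
      unfolding b[symmetric]
      by (auto simp: mem_double_annihilator mem_annihilator sup.absorb1) (metis sup.idem)
    ultimately show "\<exists>b. a\<^sup>\<top> \<inter> b\<^sup>\<top> = {top} \<and> a\<^sup>\<top> \<veebar> b\<^sup>\<top> = UNIV" by blast
  qed
  moreover have "normal_nearlattice TYPE('a) \<and> quasicomplemented TYPE('a)" if ?boolean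
  proof -
    have compl: "\<exists>b. a\<^sup>\<top>\<^sup>\<top> = b\<^sup>\<top> \<and> a\<^sup>\<top> \<veebar> b\<^sup>\<top> = UNIV" for a :: 'a
      using that[rule_format, of a] double_annihilator_eq_complement[of a] by blast
    then have "a\<^sup>\<top> \<veebar> a\<^sup>\<top>\<^sup>\<top> = UNIV" for a :: 'a
      by metis
    then show ?thesis
      using normal_nearlatticeI compl unfolding quasicomplemented_def by blast
  qed
  ultimately show ?thesis by blast
qed

end
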